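(* Let $\mathbb{F}$ be a field of characteristic $2$, let $m=(l)$ with $l$ a positive integer, $l\neq 1$, and let $W = W(1,m)$ be the Witt algebra over $\mathbb{F}$. Let $W'=[W,W]$ be its derived subalgebra. Then $\dim_{\mathbb{F}}(W') = \dim_{\mathbb{F}}(W)-1$ and $W'$ is a simple Lie algebra.
   Context: Let $\mathbb{F}$ be a field of characteristic $p>0$ (here $p=2$), $n\ge 1$, and $m=(m_1,\dots,m_n)$ a tuple of positive integers. Put $\tau=(p^{m_1}-1,\dots,p^{m_n}-1)$. The (divided power) algebra $A(n,m)$ is the commutative associative unital $\mathbb{F}$-algebra with $\mathbb{F}$-basis the symbols $X^{(a)}$ (also written $X^a$), where $a=(a_1,\dots,a_n)$ runs over tuples of non-negative integers with $0\le a\le\tau$ componentwise, and multiplication $X^{(a)}X^{(b)}=\binom{a+b}{a}X^{(a+b)}$, where $\binom{a+b}{a}=\prod_{i}\binom{a_i+b_i}{a_i}$ is evaluated modulo $p$ (the product is $0$ when $a+b\not\le\tau$, since then the coefficient vanishes modulo $p$). For $1\le j\le n$, $D_j$ is the partial derivation of $A(n,m)$ in the $j$-th variable: $D_j(X^{(a)})=X^{(a-\varepsilon_j)}$ if $a_j\ge 1$ and $D_j(X^{(a)})=0$ if $a_j=0$, with $\varepsilon_j$ the $j$-th unit vector. The Witt algebra $W(n,m)$ is the Lie algebra $\{\sum_{j=1}^n f_jD_j \mid f_j\in A(n,m)\}$ (a free $A(n,m)$-module on $D_1,\dots,D_n$) with bracket $[fD_i,gD_j]=fD_i(g)D_j-gD_j(f)D_i$;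 it has dimension $n\,p^{m_1+\cdots+m_n}$. The statement concerns the case $n=1$, $p=2$. A Lie algebra is simple if it is non-abelian and has no ideals other than $0$ and itself. *)

theory Defs
  imports
    "HOL-Library.Function_Algebras"
    "HOL-Library.Numeral_Type"
    "HOL-Computational_Algebra.Computational_Algebra"
begin

section \<open>Lie algebras\<close>

text \<open>
  A Lie algebra is given by a carrier \<open>L\<close>, a linear subspace of an ambient vector space, and a
  bracket that is only required to behave well on \<open>L\<close>. Alternation is stated as
  \<open>br x x = 0\<close>; in characteristic 2 antisymmetry would be too weak.
\<close>

locale lie_algebra = vector_space scale
  for scale :: "'a::field \<Rightarrow> 'b::ab_group_add \<Rightarrow> 'b" +
  fixes L :: "'b set" and br :: "'b \<Rightarrow> 'b \<Rightarrow> 'b"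
  assumes subspace_carrier: "subspace L"
    and br_closed: "x \<in> L \<Longrightarrow> y \<in> L \<Longrightarrow> br x y \<in> L"
    and br_add_left: "x \<in> L \<Longrightarrow> y \<in> L \<Longrightarrow> z \<in> L \<Longrightarrow> br (x + y) z = br x z + br y z"
    and br_add_right: "x \<in> L \<Longrightarrow> y \<in> L \<Longrightarrow> z \<in> L \<Longrightarrow> br x (y + z) = br x y + br x z"
    and br_scale_left: "x \<in> L \<Longrightarrow> y \<in> L \<Longrightarrow> br (scale c x) y = scale c (br x y)"
    and br_scale_right: "x \<in> L \<Longrightarrow> y \<in> L \<Longrightarrow> br x (scale c y) = scale c (br x y)"
    and br_self: "x \<in> L \<Longrightarrow> br x x = 0"
    and jacobi: "x \<in> L \<Longrightarrow> y \<in> L \<Longrightarrow> z \<in> L \<Longrightarrow>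
      br x (br y z) + br y (br z x) + br z (br x y) = 0"

definition lie_ideal ::
  "('a::field \<Rightarrow> 'b::ab_group_add \<Rightarrow> 'b) \<Rightarrow> 'b set \<Rightarrow> ('b \<Rightarrow> 'b \<Rightarrow> 'b) \<Rightarrow> 'b set \<Rightarrow> bool"
  where "lie_ideal scale L br I \<longleftrightarrow>
    module.subspace scale I \<and> I \<subseteq> L \<and> (\<forall>x\<in>L. \<forall>y\<in>I. br x y \<in> I)"

locale simple_lie_algebra = lie_algebra scale L br
  for scale :: "'a::field \<Rightarrow> 'b::ab_group_add \<Rightarrow> 'b" and L br +
  assumes non_abelian: "\<exists>x\<in>L. \<exists>y\<in>L. br x y \<noteq> 0"
    and ideal_trivial: "lie_ideal scale L br I \<Longrightarrow> I = {0} \<or> I = L"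

definition derived_subalgebra ::
  "('a::field \<Rightarrow> 'b::ab_group_add \<Rightarrow> 'b) \<Rightarrow> 'b set \<Rightarrow> ('b \<Rightarrow> 'b \<Rightarrow> 'b) \<Rightarrow> 'b set"
  where "derived_subalgebra scale L br = module.span scale {br x y | x y. x \<in> L \<and> y \<in> L}"


section \<open>Divided power algebras\<close>

text \<open>
  The finite type \<open>'n\<close> indexes the variables. A function \<open>f :: ('n \<Rightarrow> nat) \<Rightarrow> 'a\<close> stands for the
  (formal) combination of the symbols \<open>X\<^sup>(\<^sup>a\<^sup>)\<close> with coefficients \<open>f a\<close>; \<open>A(n,m)\<close> consists of
  those with \<open>f a = 0\<close> unless \<open>a \<le> \<tau>\<close>.
\<close>

definition tau :: "'a::field itself \<Rightarrow> ('n \<Rightarrow> nat) \<Rightarrow> 'n \<Rightarrow> nat"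
  where "tau _ m = (\<lambda>i. CHAR('a) ^ m i - 1)"

definition dp_algebra :: "('n::finite \<Rightarrow> nat) \<Rightarrow> (('n \<Rightarrow> nat) \<Rightarrow> 'a::field) set"
  where "dp_algebra m = {f. \<forall>a. f a \<noteq> 0 \<longrightarrow> a \<le> tau TYPE('a) m}"

definition dp_monom :: "('n::finite \<Rightarrow> nat) \<Rightarrow> ('n \<Rightarrow> nat) \<Rightarrow> 'a::field"
  where "dp_monom a = (\<lambda>c. if c = a then 1 else 0)"

definition multi_choose :: "('n::finite \<Rightarrow> nat) \<Rightarrow> ('n \<Rightarrow> nat) \<Rightarrow> nat"
  where "multi_choose c a = (\<Prod>i\<in>UNIV. c i choose a i)"

text \<open>
  The bilinear extension of \<open>X\<^sup>(\<^sup>a\<^sup>) X\<^sup>(\<^sup>b\<^sup>) = (a+b choose a) X\<^sup>(\<^sup>a\<^sup>+\<^sup>b\<^sup>)\<close>. It needs no truncation at \<open>\<tau>\<close>: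
  by \<open>multi_choose_vanish\<close> and \<open>dp_mult_closed\<close> below, the coefficient of \<open>X\<^sup>(\<^sup>a\<^sup>+\<^sup>b\<^sup>)\<close> is zero in
  the field when \<open>a, b \<le> \<tau>\<close> but not \<open>a + b \<le> \<tau>\<close>.
\<close>

definition dp_mult ::
  "(('n::finite \<Rightarrow> nat) \<Rightarrow> 'a::field) \<Rightarrow> (('n \<Rightarrow> nat) \<Rightarrow> 'a) \<Rightarrow> ('n \<Rightarrow> nat) \<Rightarrow> 'a"
  where "dp_mult f g = (\<lambda>c. \<Sum>a | a \<le> c. of_nat (multi_choose c a) * f a * g (c - a))"

text \<open>The coefficient of \<open>X\<^sup>(\<^sup>a\<^sup>)\<close> in \<open>D\<^sub>j f\<close> is that of \<open>X\<close> to the \<open>a + \<epsilon>\<^sub>j\<close> in \<open>f\<close>.\<close>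

definition dp_deriv :: "'n \<Rightarrow> (('n::finite \<Rightarrow> nat) \<Rightarrow> 'a::field) \<Rightarrow> ('n \<Rightarrow> nat) \<Rightarrow> 'a"
  where "dp_deriv j f = (\<lambda>a. f (a(j := Suc (a j))))"


section \<open>Witt algebras\<close>

text \<open>The family \<open>v\<close> of coefficients stands for the derivation \<open>\<Sum>\<^sub>j v\<^sub>j D\<^sub>j\<close>.\<close>

definition witt :: "('n::finite \<Rightarrow> nat) \<Rightarrow> ('n \<Rightarrow> ('n \<Rightarrow> nat) \<Rightarrow> 'a::field) set"
  where "witt m = {v. \<forall>j. v j \<in> dp_algebra m}"

definition witt_scale ::
  "'a::field \<Rightarrow> ('n::finite \<Rightarrow> ('n \<Rightarrow> nat) \<Rightarrow> 'a) \<Rightarrow> 'n \<Rightarrow> ('n \<Rightarrow> nat) \<Rightarrow> 'a"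
  where "witt_scale c v = (\<lambda>j a. c * v j a)"

text \<open>
  The bilinear extension of \<open>[f D\<^sub>i, g D\<^sub>j] = f D\<^sub>i(g) D\<^sub>j - g D\<^sub>j(f) D\<^sub>i\<close>, see \<open>witt_bracket_single\<close>.
\<close>

definition witt_bracket ::
  "('n::finite \<Rightarrow> ('n \<Rightarrow> nat) \<Rightarrow> 'a::field) \<Rightarrow> ('n \<Rightarrow> ('n \<Rightarrow> nat) \<Rightarrow> 'a) \<Rightarrow> 'n \<Rightarrow> ('n \<Rightarrow> nat) \<Rightarrow> 'a"
  where "witt_bracket v w =
    (\<lambda>j. \<Sum>i\<in>UNIV. dp_mult (v i) (dp_deriv i (w j)) - dp_mult (w i) (dp_deriv i (v j)))"


subsection \<open>Agreement with the defining formulas\<close>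

lemma finite_le_multi: "finite {a :: 'n::finite \<Rightarrow> nat. a \<le> c}"
proof -
  have "{a. a \<le> c} \<subseteq> {a. \<forall>i. (i \<in> UNIV \<longrightarrow> a i \<in> {.. Max (range c)}) \<and> (i \<notin> UNIV \<longrightarrow> a i = 0)}"
  proof safe
    fix a i assume "a \<le> c"
    then have "a i \<le> c i" by (rule le_funD)
    also have "c i \<le> Max (range c)" by simp
    finally show "a i \<le> Max (range c)" .
  qed auto
  then show ?thesis
    by (rule finite_subset) (rule finite_set_of_finite_funs, simp_all)
qed

lemma dp_mult_monom:
  fixes a b :: "'n::finite \<Rightarrow> nat"
  shows "dp_mult (dp_monom a) (dp_monom b) =
    (\<lambda>c. of_nat (multi_choose (a + b) a) * (dp_monom (a + b) c :: 'a::field))"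
proof
  fix c :: "'n \<Rightarrow> nat"
  have eq: "c - a = b \<longleftrightarrow> c = a + b" if "a \<le> c"
  proof -
    have "c i - a i = b i \<longleftrightarrow> c i = a i + b i" for i
      using that le_funD[of a c i] by auto
    then show ?thesis by (simp add: fun_eq_iff)
  qed
  have "dp_mult (dp_monom a) (dp_monom b) c =
      (\<Sum>a' | a' \<le> c. if a' = a then of_nat (multi_choose c a) * (dp_monom b (c - a) :: 'a) else 0)"
    unfolding dp_mult_def by (intro sum.cong) (auto simp: dp_monom_def)
  also have "\<dots> = (if a \<le> c then of_nat (multi_choose c a) * dp_monom b (c - a) else 0)"
    using finite_le_multi[of c] by (simp add: sum.delta)
  also have "\<dots> = of_nat (multi_choose (a + b) a) * dp_monom (a + b) c"
  proof (cases "c = a + b")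
    case True
    then have "a \<le> c" by (simp add: le_fun_def)
    then show ?thesis using eq True by (simp add: dp_monom_def)
  next
    case False
    then show ?thesis using eq by (simp add: dp_monom_def)
  qed
  finally show "dp_mult (dp_monom a) (dp_monom b) c =
      of_nat (multi_choose (a + b) a) * (dp_monom (a + b) c :: 'a)" .
qed

lemma dp_deriv_monom:
  "dp_deriv j (dp_monom a) = (if a j = 0 then 0 else dp_monom (a(j := a j - 1)))"
proof
  fix c
  have "c(j := Suc (c j)) = a \<longleftrightarrow> a j \<noteq> 0 \<and> c = a(j := a j - 1)"
    by (metis Suc_pred' bot_nat_0.not_eq_extremum diff_Suc_1 fun_upd_same fun_upd_triv
        fun_upd_upd nat.distinct(1))
  then show "dp_deriv j (dp_monom a) c = (if a j = 0 then 0 else dp_monom (a(j := a j - 1))) c"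
    by (simp add: dp_deriv_def dp_monom_def)
qed

lemma choose_vanish:
  fixes a b k :: nat
  assumes p: "prime CHAR('a::field)"
    and a: "a < CHAR('a) ^ k" and b: "b < CHAR('a) ^ k" and ab: "CHAR('a) ^ k \<le> a + b"
  shows "of_nat (a + b choose a) = (0 :: 'a)"
proof -
  define q where "q = CHAR('a) ^ k"
  define r where "r = a + b - q"
  have r: "a + b = q + r" "r < a" using a b ab by (auto simp: q_def r_def)
  let ?X = "monom (1::'a) 1"
  have *: "coeff ((1 + ?X) ^ n) i = of_nat (n choose i)" for n i
  proof -
    have "(1 + ?X) ^ n = (\<Sum>k\<le>n. of_nat (n choose k) * ?X ^ k)"
      using binomial_ring[of ?X 1 n] by (simp add: add.commute)
    also have "\<dots> = (\<Sum>k\<le>n. monom (of_nat (n choose k)) k)"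
      by (intro sum.cong) (simp_all add: monom_power of_nat_poly smult_monom)
    finally show ?thesis by (simp add: coeff_sum binomial_eq_0)
  qed
  have "(1 + ?X) ^ q = 1 + ?X ^ q"
  proof -
    have "prime CHAR('a poly)" using p by simp
    from freshmans_dream'[OF this, of q k 1 ?X] show ?thesis by (simp add: q_def)
  qed
  then have "(1 + ?X) ^ (a + b) = (1 + ?X) ^ r + monom 1 q * (1 + ?X) ^ r"
    by (simp add: r power_add monom_power algebra_simps)
  then have "coeff ((1 + ?X) ^ (a + b)) a = coeff ((1 + ?X) ^ r) a"
    using a by (simp add: coeff_monom_mult q_def)
  then show ?thesis unfolding * using r by (simp add: binomial_eq_0)
qed

lemma multi_choose_vanish:
  fixes a b m :: "'n::finite \<Rightarrow> nat"
  assumes p: "prime CHAR('a::field)"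
    and a: "a \<le> tau TYPE('a) m" and b: "b \<le> tau TYPE('a) m" and ab: "\<not> a + b \<le> tau TYPE('a) m"
  shows "of_nat (multi_choose (a + b) a) = (0 :: 'a)"
proof -
  obtain i where i: "\<not> a i + b i \<le> CHAR('a) ^ m i - 1"
    using ab by (auto simp: tau_def le_fun_def)
  have "CHAR('a) ^ m i > 0" using p by (simp add: prime_gt_0_nat)
  moreover have "a i \<le> CHAR('a) ^ m i - 1" "b i \<le> CHAR('a) ^ m i - 1"
    using a b by (auto simp: tau_def le_fun_def)
  ultimately have "of_nat (a i + b i choose a i) = (0 :: 'a)"
    using i by (intro choose_vanish[OF p, of _ "m i"]) auto
  then show ?thesis
    by (auto simp: multi_choose_def)
qed

lemma dp_mult_closed:
  fixes f g :: "('n::finite \<Rightarrow> nat) \<Rightarrow> 'a::field"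
  assumes p: "prime CHAR('a)" and f: "f \<in> dp_algebra m" and g: "g \<in> dp_algebra m"
  shows "dp_mult f g \<in> dp_algebra m"
  unfolding dp_algebra_def
proof (intro CollectI allI impI, rule ccontr)
  fix c assume nz: "dp_mult f g c \<noteq> 0" and c: "\<not> c \<le> tau TYPE('a) m"
  have "of_nat (multi_choose c a) * f a * g (c - a) = 0" if "a \<le> c" for a
  proof (cases "f a = 0 \<or> g (c - a) = 0")
    case False
    then have "a \<le> tau TYPE('a) m" "c - a \<le> tau TYPE('a) m"
      using f g by (auto simp: dp_algebra_def)
    moreover have "a + (c - a) = c"
      using that by (auto simp: fun_eq_iff le_fun_def)
    ultimately show ?thesis
      using multi_choose_vanish[OF p, of a m "c - a"] c by simp
  qed auto
  then have "dp_mult f g c = 0"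
    unfolding dp_mult_def by (intro sum.neutral) auto
  then show False using nz by simp
qed

lemma witt_bracket_single:
  fixes f g :: "('n::finite \<Rightarrow> nat) \<Rightarrow> 'a::field"
  shows "witt_bracket (0(i := f)) (0(j := g)) =
    0(j := dp_mult f (dp_deriv i g)) - 0(i := dp_mult g (dp_deriv j f))"
proof
  have 0: "dp_mult 0 h = 0" "dp_mult h 0 = 0" "dp_deriv k 0 = 0"
    for h :: "('n \<Rightarrow> nat) \<Rightarrow> 'a" and k :: 'n
    by (auto simp: dp_mult_def dp_deriv_def fun_eq_iff)
  fix k
  have "witt_bracket (0(i := f)) (0(j := g)) k =
    (\<Sum>l\<in>UNIV. if l = i then dp_mult f (dp_deriv i ((0(j := g)) k)) else 0)
      - (\<Sum>l\<in>UNIV. if l = j then dp_mult g (dp_deriv j ((0(i := f)) k)) else 0)"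
    unfolding witt_bracket_def sum_subtractf[symmetric]
    by (intro sum.cong) (auto simp: 0)
  then show "witt_bracket (0(i := f)) (0(j := g)) k =
    (0(j := dp_mult f (dp_deriv i g)) - 0(i := dp_mult g (dp_deriv j f))) k"
    by (simp add: 0)
qed

lemma vector_space_witt_scale: "vector_space witt_scale"
  by unfold_locales (auto simp: witt_scale_def fun_eq_iff algebra_simps)

end

theory Submission
  imports Defs
begin

text \<open>
  Write \<open>e\<^sub>k = X\<^sup>(\<^sup>k\<^sup>) D\<close> and \<open>\<tau> = 2\<^sup>l - 1\<close>. For \<open>a + b = k + 1\<close> the bracket of \<open>e\<^sub>a\<close> and \<open>e\<^sub>b\<close> is
  \<open>(k choose a) - (k choose b)\<close> times \<open>e\<^sub>k\<close>. Since \<open>[e\<^sub>0, e\<^sub>k\<^sub>+\<^sub>1] = e\<^sub>k\<close>, the derived algebra contains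
  \<open>e\<^sub>k\<close> for \<open>k < \<tau>\<close>; it does not reach \<open>e\<^sub>\<tau>\<close>, because in characteristic 2 all binomial coefficients
  \<open>\<tau> choose a\<close> are 1. A nonzero ideal of \<open>W'\<close> contains \<open>e\<^sub>0\<close> (apply \<open>ad e\<^sub>0\<close>, which lowers degrees),
  hence \<open>e\<^sub>k\<close> for \<open>k < \<tau> - 1\<close>. In particular it contains \<open>e\<^sub>1\<close> as \<open>l > 1\<close>, hence also
  \<open>e\<^sub>\<tau>\<^sub>-\<^sub>1\<close>, which up to sign is \<open>[e\<^sub>1, e\<^sub>\<tau>\<^sub>-\<^sub>1]\<close>.
\<close>

section \<open>Divided power algebras\<close>

lemma multi_choose_symmetric:
  assumes "a \<le> c"
  shows "multi_choose c (c - a) = multi_choose c a"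
  using assms unfolding multi_choose_def
  by (intro prod.cong) (auto simp: le_fun_def binomial_symmetric[symmetric])

text \<open>Trinomial revision in each coordinate; it matches the coefficients in the associativity
  proof.\<close>

lemma multi_choose_mult:
  assumes "b \<le> a" "a \<le> c"
  shows "multi_choose c a * multi_choose a b = multi_choose c b * multi_choose (c - b) (a - b)"
  using assms unfolding multi_choose_def prod.distrib[symmetric]
  by (intro prod.cong) (auto simp: le_fun_def choose_mult)

lemma multi_choose_eq_0:
  assumes "\<not> a \<le> c"
  shows "multi_choose c a = 0"
  using assms by (auto simp: multi_choose_def le_fun_def not_le binomial_eq_0)

text \<open>Pascal's rule in coordinate \<open>j\<close>. The case split is there because
  \<open>a j - 1\<close> truncates at \<open>a j = 0\<close>, where Pascal's rule has no second
  term.\<close>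

lemma multi_choose_Suc:
  "multi_choose (c(j := Suc (c j))) a =
     multi_choose c a + (if a j = 0 then 0 else multi_choose c (a(j := a j - 1)))"
proof -
  have split: "multi_choose c' a' = (c' j choose a' j) * (\<Prod>i\<in>UNIV - {j}. c' i choose a' i)" for c' a'
    unfolding multi_choose_def by (rule prod.remove) auto
  have "(\<Prod>i\<in>UNIV - {j}. (c(j := Suc (c j))) i choose a i) = (\<Prod>i\<in>UNIV - {j}. c i choose a i)"
    "(\<Prod>i\<in>UNIV - {j}. c i choose (a(j := a j - 1)) i) = (\<Prod>i\<in>UNIV - {j}. c i choose a i)"
    by (intro prod.cong; simp)+
  then show ?thesis
    unfolding split by (cases "a j") (simp_all add: algebra_simps)
qed

lemma dp_mult_commute: "dp_mult f g = dp_mult g f"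
proof
  fix c
  show "dp_mult f g c = dp_mult g f c"
    unfolding dp_mult_def
  proof (rule sum.reindex_bij_witness[where i = "\<lambda>a. c - a" and j = "\<lambda>a. c - a"])
    fix a assume "a \<in> {a. a \<le> c}"
    then have a: "a \<le> c" "c - (c - a) = a" by (auto simp: le_fun_def fun_eq_iff)
    then show "of_nat (multi_choose c (c - a)) * g (c - a) * f (c - (c - a)) =
        of_nat (multi_choose c a) * f a * g (c - a)"
      by (simp add: multi_choose_symmetric)
  qed (auto simp: le_fun_def fun_eq_iff)
qed

text \<open>Both sides sum over chains \<open>b \<le> a \<le> c\<close>; putting
  \<open>d = a - b\<close> turns one indexing into the other.\<close>

lemma dp_mult_assoc: "dp_mult (dp_mult f g) h = dp_mult f (dp_mult g h)"
proof
  fix c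
  have "dp_mult (dp_mult f g) h c =
      (\<Sum>(a, b)\<in>Sigma {a. a \<le> c} (\<lambda>a. {b. b \<le> a}).
        of_nat (multi_choose c a * multi_choose a b) * f b * g (a - b) * h (c - a))"
    unfolding dp_mult_def
    by (simp add: sum.Sigma[symmetric] finite_le_multi sum_distrib_left sum_distrib_right mult_ac)
  also have "\<dots> = (\<Sum>(b, d)\<in>Sigma {b. b \<le> c} (\<lambda>b. {d. d \<le> c - b}).
        of_nat (multi_choose c b * multi_choose (c - b) d) * f b * g d * h (c - b - d))"
  proof (rule sum.reindex_bij_witness[where i = "\<lambda>(b, d). (b + d, b)" and j = "\<lambda>(a, b). (b, a - b)"],
      goal_cases)
    case (1 x)
    then show ?case by (auto simp: le_fun_def fun_eq_iff)
  next
    case (2 x)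
    then show ?case by (auto simp: le_fun_def intro: order_trans) (meson diff_le_mono)
  next
    case (3 x)
    then show ?case by (auto simp: le_fun_def fun_eq_iff)
  next
    case (4 x)
    then show ?case by (auto simp: le_fun_def le_diff_conv2 add.commute)
  next
    case (5 x)
    then obtain a b where x: "x = (a, b)" "b \<le> a" "a \<le> c" by auto
    then have "c - b - (a - b) = c - a" by (auto simp: le_fun_def fun_eq_iff)
    then show ?case using x multi_choose_mult[of b a c] by (simp del: of_nat_mult)
  qed
  also have "\<dots> = dp_mult f (dp_mult g h) c"
    unfolding dp_mult_def
    by (simp add: sum.Sigma[symmetric] finite_le_multi sum_distrib_left sum_distrib_right mult_ac)
  finally show "dp_mult (dp_mult f g) h c = dp_mult f (dp_mult g h) c" .
qed

lemma dp_mult_left_commute: "dp_mult f (dp_mult g h) = dp_mult g (dp_mult f h)"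
  by (metis dp_mult_assoc dp_mult_commute)

lemma dp_mult_add_right: "dp_mult f (g + h) = dp_mult f g + dp_mult f h"
  by (simp add: dp_mult_def fun_eq_iff algebra_simps sum.distrib)

lemma dp_mult_add_left: "dp_mult (f + g) h = dp_mult f h + dp_mult g h"
  by (simp add: dp_mult_def fun_eq_iff algebra_simps sum.distrib)

lemma dp_mult_diff_right: "dp_mult f (g - h) = dp_mult f g - dp_mult f h"
  by (simp add: dp_mult_def fun_eq_iff algebra_simps sum_subtractf)

lemma dp_mult_diff_left: "dp_mult (f - g) h = dp_mult f h - dp_mult g h"
  by (simp add: dp_mult_def fun_eq_iff algebra_simps sum_subtractf)

lemma dp_mult_scale_left: "dp_mult (\<lambda>a. c * f a) g = (\<lambda>a. c * dp_mult f g a)"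
  by (simp add: dp_mult_def fun_eq_iff sum_distrib_left mult_ac)

lemma dp_mult_scale_right: "dp_mult f (\<lambda>a. c * g a) = (\<lambda>a. c * dp_mult f g a)"
  by (simp add: dp_mult_def fun_eq_iff sum_distrib_left mult_ac)

lemma dp_deriv_add: "dp_deriv j (f + g) = dp_deriv j f + dp_deriv j g"
  by (simp add: dp_deriv_def fun_eq_iff)

lemma dp_deriv_diff: "dp_deriv j (f - g) = dp_deriv j f - dp_deriv j g"
  by (simp add: dp_deriv_def fun_eq_iff)

lemma dp_deriv_scale: "dp_deriv j (\<lambda>a. c * f a) = (\<lambda>a. c * dp_deriv j f a)"
  by (simp add: dp_deriv_def)

text \<open>Pascal's rule splits each coefficient of the product in two: the first parts add up to
  the term with \<open>dp_deriv j g\<close>, the second to the one with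
  \<open>dp_deriv j f\<close>.\<close>

lemma dp_deriv_mult: "dp_deriv j (dp_mult f g) = dp_mult (dp_deriv j f) g + dp_mult f (dp_deriv j g)"
proof
  fix c
  let ?c = "c(j := Suc (c j))"
  have "dp_deriv j (dp_mult f g) c =
      (\<Sum>a | a \<le> ?c. of_nat (multi_choose c a) * f a * g (?c - a)) +
      (\<Sum>a | a \<le> ?c. of_nat (if a j = 0 then 0 else multi_choose c (a(j := a j - 1))) * f a * g (?c - a))"
    by (simp add: dp_deriv_def dp_mult_def multi_choose_Suc algebra_simps sum.distrib)
  \<comment> \<open>The indices below \<open>?c\<close> but not below \<open>c\<close> have
    \<open>a j = Suc (c j)\<close>, so \<open>multi_choose c a\<close> vanishes there.\<close>
  also have "(\<Sum>a | a \<le> ?c. of_nat (multi_choose c a) * f a * g (?c - a)) =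
      (\<Sum>a | a \<le> c. of_nat (multi_choose c a) * f a * g (?c - a))"
    by (rule sum.mono_neutral_right[OF finite_le_multi])
      (auto simp: multi_choose_eq_0 le_fun_def le_SucI)
  also have "\<dots> = dp_mult f (dp_deriv j g) c"
    unfolding dp_mult_def dp_deriv_def
  proof (intro sum.cong refl)
    fix a assume "a \<in> {a. a \<le> c}"
    then have "?c - a = (c - a)(j := Suc ((c - a) j))"
      by (auto simp: le_fun_def fun_eq_iff Suc_diff_le)
    then show "of_nat (multi_choose c a) * f a * g (?c - a) =
        of_nat (multi_choose c a) * f a * g ((c - a)(j := Suc ((c - a) j)))"
      by simp
  qed
  also have "(\<Sum>a | a \<le> ?c. of_nat (if a j = 0 then 0 else multi_choose c (a(j := a j - 1))) *
        f a * g (?c - a)) =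
      (\<Sum>a | a \<le> ?c \<and> a j \<noteq> 0. of_nat (multi_choose c (a(j := a j - 1))) * f a * g (?c - a))"
    by (rule sum.mono_neutral_cong_right) (auto simp: finite_le_multi)
  also have "\<dots> = dp_mult (dp_deriv j f) g c"
    unfolding dp_mult_def dp_deriv_def
  proof (rule sum.reindex_bij_witness[where i = "\<lambda>a. a(j := Suc (a j))" and j = "\<lambda>a. a(j := a j - 1)"])
    fix a assume a: "a \<in> {a. a \<le> ?c \<and> a j \<noteq> 0}"
    then show "a(j := a j - 1) \<in> {a. a \<le> c}"
      by (auto simp: le_fun_def split: if_splits)
    have "c - a(j := a j - 1) = ?c - a"
      using a by (auto simp: fun_eq_iff)
    then show "of_nat (multi_choose c (a(j := a j - 1))) *
        f ((a(j := a j - 1))(j := Suc ((a(j := a j - 1)) j))) * g (c - a(j := a j - 1)) =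
      of_nat (multi_choose c (a(j := a j - 1))) * f a * g (?c - a)"
      using a by simp
  qed (auto simp: le_fun_def)
  finally show "dp_deriv j (dp_mult f g) c = (dp_mult (dp_deriv j f) g + dp_mult f (dp_deriv j g)) c"
    by (simp add: add.commute)
qed

lemma dp_deriv_closed:
  assumes "f \<in> dp_algebra m"
  shows "dp_deriv j f \<in> dp_algebra m"
  unfolding dp_algebra_def dp_deriv_def
proof (intro CollectI allI impI)
  fix a assume "f (a(j := Suc (a j))) \<noteq> 0"
  then have "a(j := Suc (a j)) \<le> tau TYPE('b) m"
    using assms by (auto simp: dp_algebra_def)
  moreover have "a \<le> a(j := Suc (a j))" by (simp add: le_fun_def)
  ultimately show "a \<le> tau TYPE('b) m" by (rule order_trans[rotated])
qed

lemma dp_algebra_diff: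
  assumes "f \<in> dp_algebra m" "g \<in> dp_algebra m"
  shows "f - g \<in> dp_algebra m"
  using assms by (auto simp: dp_algebra_def) metis

section \<open>Binomial coefficients in positive characteristic\<close>

text \<open>With \<open>q = CHAR('a) ^ k\<close>, neighbours in row \<open>q - 1\<close> of Pascal's
  triangle add up to an inner entry of row \<open>q\<close>, which is zero in the field; so the
  entries alternate in sign, starting from 1.\<close>

lemma of_nat_choose_CHAR_power_minus_1:
  assumes p: "prime CHAR('a::field)" and "a < CHAR('a) ^ k"
  shows "of_nat (CHAR('a) ^ k - 1 choose a) = ((-1) ^ a :: 'a)"
  using assms(2)
proof (induction a)
  case (Suc a)
  let ?q = "CHAR('a) ^ k"
  have "of_nat (Suc a + (?q - Suc a) choose Suc a) = (0 :: 'a)"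
    using Suc.prems by (intro choose_vanish[OF p, where k = k]) auto
  moreover have "Suc a + (?q - Suc a) = Suc (?q - 1)"
    using Suc.prems by simp
  ultimately have "of_nat (?q - 1 choose a) + of_nat (?q - 1 choose Suc a) = (0 :: 'a)"
    by (metis binomial_Suc_Suc of_nat_add)
  then show ?case using Suc by (simp add: eq_neg_iff_add_eq_0 add.commute)
qed simp

lemma CHAR_2_imp_uminus_eq:
  assumes "CHAR('a::field) = 2"
  shows "- x = (x :: 'a)"
proof -
  have "(2 :: 'a) = 0" using of_nat_CHAR[where 'a = 'a] assms by simp
  then have "x + x = 0" by (metis mult_2 mult_zero_left)
  then show ?thesis by (simp add: minus_unique)
qed

section \<open>The Witt algebra in one variable\<close>

interpretation witt: vector_space witt_scale
  by (rule vector_space_witt_scale)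

section \<open>Coordinates with respect to the monomial basis, and dimension\<close>

definition witt_monom :: "nat \<Rightarrow> 1 \<Rightarrow> (1 \<Rightarrow> nat) \<Rightarrow> 'a::field"
  where "witt_monom k = (\<lambda>_. dp_monom (\<lambda>_. k))"

definition witt_coeff :: "(1 \<Rightarrow> (1 \<Rightarrow> nat) \<Rightarrow> 'a::field) \<Rightarrow> nat \<Rightarrow> 'a"
  where "witt_coeff v k = v 1 (\<lambda>_. k)"

text \<open>One family for both algebras: \<open>N = 2 ^ l\<close> gives W and
  \<open>N = 2 ^ l - 1\<close> gives its derived algebra.\<close>

definition witt_upto :: "nat \<Rightarrow> (1 \<Rightarrow> (1 \<Rightarrow> nat) \<Rightarrow> 'a::field) set"
  where "witt_upto N = {v. \<forall>k\<ge>N. witt_coeff v k = 0}"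

lemma witt_eqI:
  assumes "\<And>k. witt_coeff v k = witt_coeff w k"
  shows "v = w"
proof (intro ext)
  fix j :: 1 and a :: "1 \<Rightarrow> nat"
  have "j = 1" "a = (\<lambda>_. a 1)" by (auto simp: fun_eq_iff)
  then show "v j a = w j a" using assms[of "a 1"] by (metis witt_coeff_def)
qed

lemma witt_coeff_simps [simp]:
  "witt_coeff 0 k = 0"
  "witt_coeff (v + w) k = witt_coeff v k + witt_coeff w k"
  "witt_coeff (witt_scale c v) k = c * witt_coeff v k"
  "witt_coeff (witt_monom i) k = (if i = k then 1 else 0)"
  by (auto simp: witt_coeff_def witt_scale_def witt_monom_def dp_monom_def fun_eq_iff)

lemma witt_coeff_sum: "witt_coeff (\<Sum>i\<in>A. f i) k = (\<Sum>i\<in>A. witt_coeff (f i) k)"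
  by (induction A rule: infinite_finite_induct)
    (simp_all only: sum.infinite sum.empty sum.insert witt_coeff_simps not_False_eq_True)

lemma witt_coeff_combination:
  "witt_coeff (\<Sum>i<N. witt_scale (c i) (witt_monom i)) k = (if k < N then c k else 0)"
proof -
  have "witt_coeff (\<Sum>i<N. witt_scale (c i) (witt_monom i)) k = (\<Sum>i<N. if i = k then c i else 0)"
    unfolding witt_coeff_sum by (intro sum.cong) auto
  then show ?thesis by (simp add: sum.delta)
qed

lemma inj_witt_monom: "inj_on (witt_monom :: nat \<Rightarrow> _ \<Rightarrow> _ \<Rightarrow> 'a::field) A"
proof (rule inj_onI)
  fix i k :: nat assume "witt_monom i = (witt_monom k :: _ \<Rightarrow> _ \<Rightarrow> 'a)"
  then have "witt_coeff (witt_monom i :: _ \<Rightarrow> _ \<Rightarrow> 'a) i = witt_coeff (witt_monom k) i" by simp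
  then show "i = k" by (simp split: if_splits)
qed

lemma subspace_witt_upto: "witt.subspace (witt_upto N)"
  by (auto simp: witt.subspace_def witt_upto_def)

lemma span_witt_monom:
  "witt.span (witt_monom ` {..<N}) = (witt_upto N :: (1 \<Rightarrow> (1 \<Rightarrow> nat) \<Rightarrow> 'a::field) set)" (is "?S = ?U")
proof
  show "?S \<subseteq> ?U"
    by (rule witt.span_minimal[OF _ subspace_witt_upto]) (auto simp: witt_upto_def)
  show "?U \<subseteq> ?S"
  proof
    fix v :: "1 \<Rightarrow> (1 \<Rightarrow> nat) \<Rightarrow> 'a" assume v: "v \<in> ?U"
    have "v = (\<Sum>i<N. witt_scale (witt_coeff v i) (witt_monom i))"
      using v by (intro witt_eqI) (auto simp: witt_upto_def witt_coeff_combination)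
    also have "\<dots> \<in> ?S"
      by (intro witt.span_sum witt.span_scale witt.span_base) auto
    finally show "v \<in> ?S" .
  qed
qed

lemma independent_witt_monom:
  "witt.independent (witt_monom ` {..<N} :: (1 \<Rightarrow> (1 \<Rightarrow> nat) \<Rightarrow> 'a::field) set)"
proof (rule witt.independent_if_scalars_zero)
  fix f :: "(1 \<Rightarrow> (1 \<Rightarrow> nat) \<Rightarrow> 'a) \<Rightarrow> 'a" and x :: "1 \<Rightarrow> (1 \<Rightarrow> nat) \<Rightarrow> 'a"
  assume sum: "(\<Sum>x\<in>witt_monom ` {..<N}. witt_scale (f x) x) = 0" and "x \<in> witt_monom ` {..<N}"
  then obtain k where k: "k < N" "x = witt_monom k" by auto
  have "(\<Sum>i<N. witt_scale (f (witt_monom i)) (witt_monom i)) = 0"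
    using sum by (simp add: sum.reindex[OF inj_witt_monom])
  then have "witt_coeff (\<Sum>i<N. witt_scale (f (witt_monom i)) (witt_monom i)) k = 0"
    by simp
  then show "f x = 0"
    using k by (simp add: witt_coeff_combination)
qed simp

lemma dim_witt_upto: "witt.dim (witt_upto N :: (1 \<Rightarrow> (1 \<Rightarrow> nat) \<Rightarrow> 'a::field) set) = N"
  using witt.dim_span_eq_card_independent[OF independent_witt_monom, of N, where 'a = 'a]
  by (simp add: span_witt_monom card_image inj_witt_monom)

lemma witt_eq_witt_upto:
  assumes "CHAR('a::field) > 0"
  shows "witt (\<lambda>_. l) = (witt_upto (CHAR('a) ^ l) :: (1 \<Rightarrow> (1 \<Rightarrow> nat) \<Rightarrow> 'a) set)"
proof -
  have all: "(\<forall>a. P a) \<longleftrightarrow> (\<forall>k. P (\<lambda>_. k))" for P :: "(1 \<Rightarrow> nat) \<Rightarrow> bool"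
  proof
    assume *: "\<forall>k. P (\<lambda>_. k)"
    show "\<forall>a. P a"
    proof
      fix a :: "1 \<Rightarrow> nat"
      have "a = (\<lambda>_. a 1)" by (auto simp: fun_eq_iff)
      with * show "P a" by metis
    qed
  qed blast
  \<comment> \<open>The subtraction in \<open>tau\<close> is truncated, so positivity of the power
    matters.\<close>
  have "k \<le> CHAR('a) ^ l - 1 \<longleftrightarrow> \<not> CHAR('a) ^ l \<le> k" for k
  proof -
    have "CHAR('a) ^ l > 0" using assms by simp
    then show ?thesis by linarith
  qed
  then show ?thesis
    by (auto simp: witt_def dp_algebra_def witt_upto_def witt_coeff_def tau_def le_fun_def all)
qed

section \<open>The Lie algebra axioms in one variable\<close>

lemma UNIV_num1: "(UNIV :: 1 set) = {1}"
  by auto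

lemma witt_bracket_num1:
  fixes v w :: "1 \<Rightarrow> (1 \<Rightarrow> nat) \<Rightarrow> 'a::field"
  shows "witt_bracket v w = (\<lambda>_. dp_mult (v 1) (dp_deriv 1 (w 1)) - dp_mult (w 1) (dp_deriv 1 (v 1)))"
proof
  fix j :: 1
  show "witt_bracket v w j =
      dp_mult (v 1) (dp_deriv 1 (w 1)) - dp_mult (w 1) (dp_deriv 1 (v 1))"
    unfolding num1_eq1[of j] by (simp add: witt_bracket_def UNIV_num1)
qed

text \<open>The product is commutative and associative and \<open>dp_deriv 1\<close> is a derivation
  of it; once the Leibniz rule is expanded, all terms cancel. No bound on the degrees
  enters.\<close>

lemma witt_bracket_jacobi:
  fixes u v w :: "1 \<Rightarrow> (1 \<Rightarrow> nat) \<Rightarrow> 'a::field"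
  shows "witt_bracket u (witt_bracket v w) + witt_bracket v (witt_bracket w u) +
    witt_bracket w (witt_bracket u v) = 0"
proof
  fix j :: 1
  show "(witt_bracket u (witt_bracket v w) + witt_bracket v (witt_bracket w u) +
    witt_bracket w (witt_bracket u v)) j = 0 j"
    by (simp add: witt_bracket_num1 dp_mult_add_right dp_mult_add_left dp_mult_diff_right
        dp_mult_diff_left dp_deriv_diff dp_deriv_mult dp_mult_assoc dp_mult_commute
        dp_mult_left_commute algebra_simps)
qed

lemma witt_bracket_closed:
  assumes "prime CHAR('a::field)" "v \<in> witt m" "w \<in> witt m"
  shows "witt_bracket v w \<in> (witt m :: (1 \<Rightarrow> (1 \<Rightarrow> nat) \<Rightarrow> 'a) set)"
  using assms
  by (auto simp: witt_bracket_num1 witt_def intro!: dp_algebra_diff dp_mult_closed dp_deriv_closed)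

text \<open>The identities hold for arbitrary coefficient functions, so only closure depends on
  \<open>L\<close>. This lets the derived algebra be treated directly.\<close>

lemma lie_algebra_witt_subspace:
  fixes L :: "(1 \<Rightarrow> (1 \<Rightarrow> nat) \<Rightarrow> 'a::field) set"
  assumes "witt.subspace L" "\<And>v w. v \<in> L \<Longrightarrow> w \<in> L \<Longrightarrow> witt_bracket v w \<in> L"
  shows "lie_algebra witt_scale L witt_bracket"
proof unfold_locales
  fix c :: 'a and u v w :: "1 \<Rightarrow> (1 \<Rightarrow> nat) \<Rightarrow> 'a"
  show "witt_bracket (u + v) w = witt_bracket u w + witt_bracket v w"
    "witt_bracket u (v + w) = witt_bracket u v + witt_bracket u w"
    by (simp_all add: witt_bracket_num1 fun_eq_iff dp_mult_add_left dp_mult_add_right dp_deriv_add)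
  show "witt_bracket (witt_scale c u) v = witt_scale c (witt_bracket u v)"
    "witt_bracket u (witt_scale c v) = witt_scale c (witt_bracket u v)"
    by (simp_all add: witt_bracket_num1 witt_scale_def fun_eq_iff dp_mult_scale_left
        dp_mult_scale_right dp_deriv_scale algebra_simps)
  show "witt_bracket u u = 0"
    by (simp add: witt_bracket_num1 fun_eq_iff)
  show "witt_bracket u (witt_bracket v w) + witt_bracket v (witt_bracket w u) +
    witt_bracket w (witt_bracket u v) = 0"
    by (rule witt_bracket_jacobi)
qed (use assms in auto)

section \<open>Structure constants of the bracket\<close>

lemma dp_mult_num1:
  fixes f g :: "(1 \<Rightarrow> nat) \<Rightarrow> 'a::field"
  shows "dp_mult f g (\<lambda>_. k) = (\<Sum>i\<le>k. of_nat (k choose i) * f (\<lambda>_. i) * g (\<lambda>_. k - i))"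
  unfolding dp_mult_def
proof (rule sum.reindex_bij_witness[where i = "\<lambda>i _. i" and j = "\<lambda>a. a 1"])
  fix a :: "1 \<Rightarrow> nat" assume "a \<in> {a. a \<le> (\<lambda>_. k)}"
  show a: "(\<lambda>_. a 1) = a" by (auto simp: fun_eq_iff)
  have "multi_choose (\<lambda>_. k) a = (k choose a 1)" by (simp add: multi_choose_def UNIV_num1)
  moreover have "(\<lambda>_. k - a 1) = (\<lambda>_. k) - a" using a by (auto simp: fun_eq_iff)
  ultimately show "of_nat (k choose a 1) * f (\<lambda>_. a 1) * g (\<lambda>_. k - a 1) =
      of_nat (multi_choose (\<lambda>_. k) a) * f a * g ((\<lambda>_. k) - a)"
    using a by simp
qed (auto simp: le_fun_def)

lemma witt_coeff_bracket:
  "witt_coeff (witt_bracket v w) k =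
    (\<Sum>i\<le>k. of_nat (k choose i) *
      (witt_coeff v i * witt_coeff w (Suc (k - i)) - witt_coeff w i * witt_coeff v (Suc (k - i))))"
proof -
  have "dp_deriv 1 f (\<lambda>_. i) = f (\<lambda>_. Suc i)" for f :: "(1 \<Rightarrow> nat) \<Rightarrow> 'a" and i
    by (auto simp: dp_deriv_def fun_upd_def)
  then show ?thesis
    by (simp add: witt_coeff_def witt_bracket_num1 dp_mult_num1 sum_subtractf algebra_simps)
qed

text \<open>Writing the degree as \<open>a + b = Suc k\<close> avoids a truncated subtraction and
  leaves out only \<open>a = b = 0\<close>, where the bracket is zero anyway.\<close>

lemma witt_bracket_monom:
  assumes "a + b = Suc k"
  shows "witt_bracket (witt_monom a) (witt_monom b) =
    witt_scale (of_nat (k choose a) - of_nat (k choose b) :: 'a::field) (witt_monom k)"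
proof (rule witt_eqI)
  fix i
  have half: "(\<Sum>j\<le>i. of_nat (i choose j) * (if a' = j then if b' = Suc (i - j) then 1 else 0 else 0)) =
      (if i = k then of_nat (k choose a') else (0 :: 'a))" if "a' + b' = Suc k" for a' b'
  proof -
    have "(\<Sum>j\<le>i. of_nat (i choose j) * (if a' = j then if b' = Suc (i - j) then 1 else 0 else 0)) =
      (\<Sum>j\<le>i. if a' = j then of_nat (i choose a') * (if b' = Suc (i - a') then 1 else 0) else (0 :: 'a))"
      by (intro sum.cong) auto
    also have "\<dots> = (if a' \<le> i then of_nat (i choose a') * (if b' = Suc (i - a') then 1 else 0) else 0)"
      by (simp add: sum.delta)
    \<comment> \<open>In the boundary case \<open>b' = 0\<close> one has \<open>a' = Suc k\<close>,
      and both sides are zero.\<close>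
    also have "\<dots> = (if i = k then of_nat (k choose a') else 0)"
      using that by (auto simp: binomial_eq_0)
    finally show ?thesis .
  qed
  have "witt_coeff (witt_bracket (witt_monom a) (witt_monom b) :: _ \<Rightarrow> _ \<Rightarrow> 'a) i =
    (\<Sum>j\<le>i. of_nat (i choose j) * (if a = j then if b = Suc (i - j) then 1 else 0 else 0)) -
    (\<Sum>j\<le>i. of_nat (i choose j) * (if b = j then if a = Suc (i - j) then 1 else (0 :: 'a) else 0))"
    unfolding witt_coeff_bracket sum_subtractf[symmetric] by (intro sum.cong) auto
  then show "witt_coeff (witt_bracket (witt_monom a) (witt_monom b)) i =
      witt_coeff (witt_scale (of_nat (k choose a) - of_nat (k choose b) :: 'a) (witt_monom k)) i"
    using half[of a b] half[of b a] assms by (simp add: add.commute)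
qed

lemma witt_bracket_monom_0: "witt_bracket (witt_monom 0) (witt_monom (Suc k)) = witt_monom k"
  by (rule witt_eqI) (auto simp: witt_bracket_monom binomial_eq_0)

text \<open>\<open>witt_monom 1\<close> is the grading element: each monomial is an eigenvector,
  with eigenvalue its degree minus 1.\<close>

lemma witt_bracket_monom_1:
  "witt_bracket (witt_monom 1) (witt_monom k) = witt_scale (of_nat k - 1) (witt_monom k)"
  using witt_bracket_monom[of 1 k k] by simp

text \<open>\<open>witt_monom 0\<close> is the derivation D itself, whose adjoint action
  differentiates coefficients and hence shifts them.\<close>

lemma witt_coeff_bracket_monom_0: "witt_coeff (witt_bracket (witt_monom 0) v) k = witt_coeff v (Suc k)"
proof -
  have "witt_coeff (witt_bracket (witt_monom 0) v) k =
      (\<Sum>i\<le>k. if i = 0 then witt_coeff v (Suc k) else 0)"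
    unfolding witt_coeff_bracket by (intro sum.cong) auto
  then show ?thesis by simp
qed

section \<open>The derived algebra in characteristic 2\<close>

text \<open>As every binomial coefficient in the top row is 1, the two halves of the bracket become
  sums that the reflection of the index exchanges.\<close>

lemma witt_coeff_bracket_top:
  fixes v w :: "1 \<Rightarrow> (1 \<Rightarrow> nat) \<Rightarrow> 'a::field"
  assumes char: "CHAR('a) = 2" and vw: "v \<in> witt_upto (2 ^ l)" "w \<in> witt_upto (2 ^ l)"
  shows "witt_coeff (witt_bracket v w) (2 ^ l - 1) = 0"
proof -
  define t :: nat where "t = 2 ^ l - 1"
  have Suc_t: "Suc t = 2 ^ l" by (simp add: t_def)
  have top: "witt_coeff v (Suc t) = 0" "witt_coeff w (Suc t) = 0"
    using vw by (auto simp: witt_upto_def Suc_t)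
  have one: "of_nat (t choose i) = (1 :: 'a)" if "i \<le> t" for i
  proof -
    have "i < 2 ^ l" using that by (simp flip: Suc_t)
    moreover have "(- 1) ^ i = (1 :: 'a)" by (simp only: CHAR_2_imp_uminus_eq[OF char] power_one)
    ultimately show ?thesis
      using of_nat_choose_CHAR_power_minus_1[of i l, where 'a = 'a] char by (simp add: t_def)
  qed
  have "witt_coeff (witt_bracket v w) t =
      (\<Sum>i\<le>t. witt_coeff v i * witt_coeff w (Suc (t - i))) -
      (\<Sum>i\<le>t. witt_coeff w i * witt_coeff v (Suc (t - i)))"
    unfolding witt_coeff_bracket sum_subtractf[symmetric] by (intro sum.cong) (simp_all add: one)
  also have "(\<Sum>i\<le>t. witt_coeff v i * witt_coeff w (Suc (t - i))) =
      (\<Sum>i\<in>{1..t}. witt_coeff v i * witt_coeff w (Suc (t - i)))"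
    by (rule sum.mono_neutral_right) (use top in \<open>auto simp: Suc_le_eq\<close>)
  also have "\<dots> = (\<Sum>i\<in>{1..t}. witt_coeff w i * witt_coeff v (Suc (t - i)))"
    by (rule sum.reindex_bij_witness[where i = "\<lambda>i. Suc (t - i)" and j = "\<lambda>i. Suc (t - i)"])
      (auto simp: Suc_diff_le)
  also have "\<dots> = (\<Sum>i\<le>t. witt_coeff w i * witt_coeff v (Suc (t - i)))"
    by (rule sum.mono_neutral_left) (use top in \<open>auto simp: Suc_le_eq\<close>)
  finally show ?thesis by (simp add: t_def)
qed

lemma witt_bracket_upto_CHAR_2:
  fixes v w :: "1 \<Rightarrow> (1 \<Rightarrow> nat) \<Rightarrow> 'a::field"
  assumes char: "CHAR('a) = 2" and vw: "v \<in> witt_upto (2 ^ l)" "w \<in> witt_upto (2 ^ l)"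
  shows "witt_bracket v w \<in> witt_upto (2 ^ l - 1)"
proof -
  have "witt_bracket v w \<in> witt_upto (2 ^ l)"
    using witt_bracket_closed[of v "\<lambda>_. l" w] vw char witt_eq_witt_upto[of l, where 'a = 'a] by simp
  moreover have "k \<ge> 2 ^ l" if "k \<ge> 2 ^ l - 1" "k \<noteq> 2 ^ l - 1" for k :: nat
    using that by linarith
  ultimately show ?thesis
    using witt_coeff_bracket_top[OF assms] unfolding witt_upto_def by blast
qed

lemma derived_witt_CHAR_2:
  assumes char: "CHAR('a::field) = 2"
  shows "derived_subalgebra witt_scale (witt_upto (2 ^ l)) witt_bracket =
    (witt_upto (2 ^ l - 1) :: (1 \<Rightarrow> (1 \<Rightarrow> nat) \<Rightarrow> 'a) set)" (is "?D = ?U")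
proof
  show "?D \<subseteq> ?U"
    unfolding derived_subalgebra_def
    by (rule witt.span_minimal[OF _ subspace_witt_upto]) (use witt_bracket_upto_CHAR_2[OF char] in blast)
  show "?U \<subseteq> ?D"
    unfolding derived_subalgebra_def span_witt_monom[symmetric]
  proof (rule witt.span_mono, safe)
    fix k :: nat assume k: "k < 2 ^ l - 1"
    have "witt_monom k = witt_bracket (witt_monom 0) (witt_monom (Suc k) :: _ \<Rightarrow> _ \<Rightarrow> 'a)"
      by (rule witt_bracket_monom_0[symmetric])
    \<comment> \<open>The unfolding above has also rewritten W as a span, hence this form of
      membership.\<close>
    moreover have "witt_monom 0 \<in> witt.span (witt_monom ` {..<2 ^ l})"
      "witt_monom (Suc k) \<in> witt.span (witt_monom ` {..<2 ^ l})"
      using k by (auto intro!: witt.span_base imageI)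
    ultimately show "\<exists>x y. (witt_monom k :: _ \<Rightarrow> _ \<Rightarrow> 'a) = witt_bracket x y \<and>
        x \<in> witt.span (witt_monom ` {..<2 ^ l}) \<and> y \<in> witt.span (witt_monom ` {..<2 ^ l})"
      by blast
  qed
qed

section \<open>Ideals and simplicity\<close>

text \<open>If \<open>d\<close> is the degree of \<open>v\<close>, then \<open>d\<close>
  applications of the shift leave only the leading coefficient, now in degree 0.\<close>

lemma ideal_witt_monom_0:
  fixes I :: "(1 \<Rightarrow> (1 \<Rightarrow> nat) \<Rightarrow> 'a::field) set"
  assumes I: "witt.subspace I" "I \<subseteq> witt_upto N" "v \<in> I" "v \<noteq> 0"
    and ad: "\<And>w. w \<in> I \<Longrightarrow> witt_bracket (witt_monom 0) w \<in> I"
  shows "witt_monom 0 \<in> I"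
proof -
  define d where "d = (GREATEST k. witt_coeff v k \<noteq> 0)"
  obtain k where k: "witt_coeff v k \<noteq> 0" using \<open>v \<noteq> 0\<close> witt_eqI[of v 0] by auto
  have bound: "i \<le> N" if "witt_coeff v i \<noteq> 0" for i
  proof (rule ccontr)
    assume "\<not> i \<le> N"
    moreover have "v \<in> witt_upto N" using I by blast
    ultimately show False using that by (simp add: witt_upto_def)
  qed
  have d: "witt_coeff v d \<noteq> 0"
    unfolding d_def by (rule GreatestI_nat[where P = "\<lambda>k. witt_coeff v k \<noteq> 0", OF k bound])
  have above: "witt_coeff v i = 0" if "i > d" for i
    using Greatest_le_nat[where P = "\<lambda>k. witt_coeff v k \<noteq> 0" and b = N and k = i] bound that
    unfolding d_def by force
  let ?w = "(witt_bracket (witt_monom 0) ^^ d) v"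
  have "(witt_bracket (witt_monom 0) ^^ n) v \<in> I \<and>
      (\<forall>i. witt_coeff ((witt_bracket (witt_monom 0) ^^ n) v) i = witt_coeff v (n + i))" for n
    by (induction n) (auto simp: ad \<open>v \<in> I\<close> witt_coeff_bracket_monom_0)
  then have w: "?w \<in> I" "witt_coeff ?w i = witt_coeff v (d + i)" for i
    by auto
  have "witt_monom 0 = witt_scale (inverse (witt_coeff v d)) ?w"
    by (rule witt_eqI) (auto simp: w(2) d above)
  also have "\<dots> \<in> I"
    by (rule witt.subspace_scale[OF I(1) w(1)])
  finally show ?thesis .
qed

lemma simple_witt_CHAR_2:
  assumes char: "CHAR('a::field) = 2" and l: "l \<ge> 2"
  shows "simple_lie_algebra witt_scale (witt_upto (2 ^ l - 1) :: (1 \<Rightarrow> (1 \<Rightarrow> nat) \<Rightarrow> 'a) set)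
    witt_bracket"
proof -
  let ?U = "witt_upto (2 ^ l - 1) :: (1 \<Rightarrow> (1 \<Rightarrow> nat) \<Rightarrow> 'a) set"
  have "(2::nat) ^ 2 \<le> 2 ^ l" using l by (intro power_increasing) auto
  \<comment> \<open>This puts the monomials of degree 0 and 1 into \<open>?U\<close>, and makes
    \<open>low\<close> below applicable to degree 1, where it asks for
    \<open>2 < 2 ^ l - 1\<close>.\<close>
  then have four: "(4::nat) \<le> 2 ^ l" by simp
  have monom: "witt_monom k \<in> ?U" if "k < 2 ^ l - 1" for k
    using that by (auto simp: witt_upto_def)
  interpret lie_algebra witt_scale ?U witt_bracket
  proof (rule lie_algebra_witt_subspace[OF subspace_witt_upto])
    fix v w assume "v \<in> ?U" "w \<in> ?U"
    then show "witt_bracket v w \<in> ?U"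
      by (intro witt_bracket_upto_CHAR_2[OF char]) (auto simp: witt_upto_def)
  qed
  show ?thesis
  proof unfold_locales
    have "witt_bracket (witt_monom 0) (witt_monom (Suc 0)) \<noteq> (0 :: _ \<Rightarrow> _ \<Rightarrow> 'a)"
      unfolding witt_bracket_monom_0 by (metis witt_coeff_simps(1,4) zero_neq_one)
    then show "\<exists>x\<in>?U. \<exists>y\<in>?U. witt_bracket x y \<noteq> 0"
      using monom[of 0] monom[of "Suc 0"] four by fastforce
  next
    fix I :: "(1 \<Rightarrow> (1 \<Rightarrow> nat) \<Rightarrow> 'a) set"
    assume "lie_ideal witt_scale ?U witt_bracket I"
    then have I: "witt.subspace I" "I \<subseteq> ?U" and
      ideal: "\<And>v w. v \<in> ?U \<Longrightarrow> w \<in> I \<Longrightarrow> witt_bracket v w \<in> I"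
      by (auto simp: lie_ideal_def)
    \<comment> \<open>\<open>lie_ideal\<close> has the element of the ideal on the right only;
      antisymmetry gives the other side.\<close>
    have swap: "witt_bracket v w \<in> I" if "v \<in> I" "w \<in> ?U" for v w
    proof -
      have "witt_bracket v w = - witt_bracket w v"
        by (simp add: witt_bracket_num1 fun_eq_iff)
      then show ?thesis using ideal[OF that(2,1)] I(1) by (simp add: witt.subspace_neg)
    qed
    show "I = {0} \<or> I = ?U"
    proof (cases "I = {0}")
      case False
      then obtain v where v: "v \<in> I" "v \<noteq> 0" using witt.subspace_0[OF I(1)] by auto
      have zero: "witt_monom 0 \<in> I"
        using ideal_witt_monom_0[OF I v] ideal monom[of 0] four by force
      \<comment> \<open>The monomial of degree \<open>Suc k\<close> must lie in \<open>?U\<close>,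
        so this misses exactly the top degree \<open>2 ^ l - 2\<close>.\<close>
      have low: "witt_monom k \<in> I" if "Suc k < 2 ^ l - 1" for k
        using swap[OF zero monom[OF that]] by (simp add: witt_bracket_monom_0)
      have high: "witt_monom (2 ^ l - 2) \<in> I"
      proof -
        \<comment> \<open>The top degree is even, so its eigenvalue under
          \<open>witt_monom 1\<close> is -1, which is invertible.\<close>
        have "(2 :: 'a) = 0" using of_nat_CHAR[where 'a = 'a] char by simp
        moreover have "even (2 ^ l - 2 :: nat)" using l by simp
        ultimately have "of_nat (2 ^ l - 2) = (0 :: 'a)"
          by (metis evenE mult_zero_left of_nat_mult of_nat_numeral)
        then have "witt_bracket (witt_monom 1) (witt_monom (2 ^ l - 2)) =
            - (witt_monom (2 ^ l - 2) :: _ \<Rightarrow> _ \<Rightarrow> 'a)"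
          by (simp only: witt_bracket_monom_1) simp
        moreover have "witt_bracket (witt_monom 1) (witt_monom (2 ^ l - 2)) \<in> I"
          using four by (intro swap low monom) auto
        ultimately show ?thesis
          using witt.subspace_neg[OF I(1)] by (metis minus_minus)
      qed
      have "witt_monom k \<in> I" if "k < 2 ^ l - 1" for k
        using that low[of k] high by (cases "k = 2 ^ l - 2") auto
      then have "?U \<subseteq> I"
        unfolding span_witt_monom[symmetric] by (intro witt.span_minimal I(1)) auto
      then show ?thesis using I(2) by auto
    qed simp
  qed
qed

theorem theorem2:
  fixes l :: nat and W W' :: "(1 \<Rightarrow> (1 \<Rightarrow> nat) \<Rightarrow> 'a::field) set"
  assumes "CHAR('a) = 2"
    and "l > 0" and "l \<noteq> 1"
    and "W = witt (\<lambda>_. l)"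
    and "W' = derived_subalgebra witt_scale W witt_bracket"
  shows "int (vector_space.dim witt_scale W') = int (vector_space.dim witt_scale W) - 1
    \<and> simple_lie_algebra witt_scale W' witt_bracket"
proof -
  have W: "W = witt_upto (2 ^ l)"
    using assms witt_eq_witt_upto[of l, where 'a = 'a] by simp
  then have W': "W' = witt_upto (2 ^ l - 1)"
    using assms derived_witt_CHAR_2 by blast
  have "int (2 ^ l - 1) = int (2 ^ l) - 1" by (simp add: of_nat_diff)
  then show ?thesis
    using simple_witt_CHAR_2[OF assms(1), of l] assms(2,3) by (simp add: W W' dim_witt_upto)
qed

end
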